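(* Let $G$ be a connected locally connected $(K_1+(K_1\cup K_2))$-free graph of order at least $3$. Then: (i) $G$ is weakly pancyclic. (ii) $G$ is fully cycle extendable if and only if $2\delta(G)\geq n(G)$.
   Context: All graphs are finite, simple, and undirected. $n(G)$ is the order (number of vertices) and $\delta(G)$ the minimum degree of $G$; $N_G(u)$ is the (open) neighborhood of $u$ in $G$. $G$ is locally connected if for every vertex $u$ of $G$ the induced subgraph $G[N_G(u)]$ is connected. For disjoint graphs $G,H$, $G\cup H$ is their disjoint union and $G+H$ their join (all edges between $G$ and $H$ are added to $G\cup H$); $K_n$ is the complete graph of order $n$. A graph is $F$-free if it does not contain $F$ as an induced subgraph (up to isomorphism). The girth $g(G)$ and circumference $c(G)$ are the minimum and maximum order of a cycle in $G$, respectively; $G$ is weakly pancyclic if it has a cycle of order $\ell$ for every integer $\ell$ with $g(G)\leq \ell\leq c(G)$. A cycle $C$ in $G$ is extendable if $G$ contains a cycle $C'$ of order $n(C)+1$ with $V(C)\subseteq V(C')$. $G$ is fully cycle extendable if every vertex of $G$ lies on a triangle and every cycle in $G$ of order less than $n(G)$ is extendable. *)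

theory Defs
  imports "Graph_Theory.Graph_Theory" "HOL-Library.Extended_Nat"
begin

text \<open>
  Finite simple undirected graphs are rendered by the locale \<^locale>\<open>pair_graph\<close>: finite, loop-free,
  symmetric digraphs whose arcs are pairs of vertices, so that an undirected edge is a pair of
  opposite arcs.
\<close>

subsection \<open>Complete graphs, disjoint union, join\<close>

definition complete_graph :: "nat \<Rightarrow> nat pair_pre_digraph" where
  "complete_graph n = \<lparr> pverts = {..<n}, parcs = {(u, v). u < n \<and> v < n \<and> u \<noteq> v} \<rparr>"

definition graph_union ::
    "'a pair_pre_digraph \<Rightarrow> 'b pair_pre_digraph \<Rightarrow> ('a + 'b) pair_pre_digraph" where
  "graph_union G H = \<lparr> pverts = pverts G <+> pverts H,
     parcs = map_prod Inl Inl ` parcs G \<union> map_prod Inr Inr ` parcs H \<rparr>"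

definition graph_join ::
    "'a pair_pre_digraph \<Rightarrow> 'b pair_pre_digraph \<Rightarrow> ('a + 'b) pair_pre_digraph" where
  "graph_join G H = \<lparr> pverts = pverts (graph_union G H),
     parcs = parcs (graph_union G H)
       \<union> (Inl ` pverts G) \<times> (Inr ` pverts H) \<union> (Inr ` pverts H) \<times> (Inl ` pverts G) \<rparr>"

lemma complete_digraph_complete_graph: "complete_digraph n (with_proj (complete_graph n))"
  by (auto simp: complete_digraph_pair_def complete_graph_def)

lemma pair_graph_complete_graph: "pair_graph (complete_graph n)"
  by (rule pair_graphI_complete[OF complete_digraph_complete_graph])

lemma pair_graph_graph_union:
  assumes "pair_graph G" "pair_graph H"
  shows "pair_graph (graph_union G H)"
proof -
  interpret G: pair_graph G by fact
  interpret H: pair_graph H by fact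
  show ?thesis
    by unfold_locales
      (auto simp: graph_union_def symmetric_def intro!: symI
        dest: G.in_arcsD1 G.in_arcsD2 H.in_arcsD1 H.in_arcsD2 G.no_loops' H.no_loops'
          G.arcs_symmetric H.arcs_symmetric)
qed

lemma pair_graph_graph_join:
  assumes "pair_graph G" "pair_graph H"
  shows "pair_graph (graph_join G H)"
proof -
  interpret G: pair_graph G by fact
  interpret H: pair_graph H by fact
  interpret U: pair_graph "graph_union G H" using assms by (rule pair_graph_graph_union)
  have [simp]: "pverts (graph_union G H) = pverts G <+> pverts H"
    by (simp add: graph_union_def)
  show ?thesis
    using U.pair_finite_arcs U.arc_fst_in_verts U.arc_snd_in_verts
    by unfold_locales
      (auto simp: graph_join_def symmetric_def intro!: symI
        dest: U.arcs_symmetric U.no_loops')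
qed

definition induced_free :: "'b pair_pre_digraph \<Rightarrow> 'a pair_pre_digraph \<Rightarrow> bool" where
  "induced_free F G \<longleftrightarrow>
     \<not> (\<exists>H. induced_subgraph H (with_proj G) \<and> digraph_iso H (with_proj F))"

subsection \<open>Degrees and neighbourhoods\<close>

text \<open>In a symmetric digraph, in-degree and out-degree of a vertex agree.\<close>

definition min_degree :: "'a pair_pre_digraph \<Rightarrow> nat" where
  "min_degree G = Min (out_degree (with_proj G) ` pverts G)"

definition neighborhood :: "'a pair_pre_digraph \<Rightarrow> 'a \<Rightarrow> 'a set" where
  "neighborhood G u = {v. (u, v) \<in> parcs G}"

text \<open>\<^const>\<open>connected\<close> fails for the graph without vertices, so an isolated vertex violates the
  following condition.  Connected graphs of order at least 2 have no isolated vertices.\<close>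

definition locally_connected :: "'a pair_pre_digraph \<Rightarrow> bool" where
  "locally_connected G \<longleftrightarrow>
     (\<forall>u \<in> pverts G. connected (with_proj G \<restriction> neighborhood G u))"

subsection \<open>Cycles\<close>

text \<open>Cycles are represented by lists of consecutive arcs.  The lower bound on the length excludes
  the closed walks \<open>[(u, v), (v, u)]\<close>, which are cycles of the symmetric digraph but not of the
  undirected graph.  A cycle of order \<open>n\<close> has \<open>n\<close> arcs, and each of its vertices is the tail
  of one of them.\<close>

definition graph_cycle :: "'a pair_pre_digraph \<Rightarrow> ('a \<times> 'a) awalk \<Rightarrow> bool" where
  "graph_cycle G p \<longleftrightarrow> pre_digraph.cycle (with_proj G) p \<and> 3 \<le> length p"

definition cycle_verts :: "('a \<times> 'a) awalk \<Rightarrow> 'a set" where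
  "cycle_verts p = fst ` set p"

lemma card_cycle_verts:
  assumes "graph_cycle G p"
  shows "card (cycle_verts p) = length p"
proof -
  obtain u where u: "pre_digraph.awalk (with_proj G) u p u" "distinct (tl (pawalk_verts u p))"
    using assms
    by (auto simp: graph_cycle_def pre_digraph.cycle_def awalk_verts_with_proj_eq)
  have verts: "pawalk_verts v p = map fst p @ [w]" if "pcas v p w" for v w
    using that by (induct p arbitrary: v) auto
  have "pcas u p u"
    using u(1) by (simp add: pre_digraph.awalk_def cas_with_proj_eq)
  moreover obtain e q where p: "p = e # q"
    using assms by (cases p) (auto simp: graph_cycle_def)
  ultimately have "distinct (map fst p)"
    using u(2) verts[of u u] by auto
  then show ?thesis
    unfolding cycle_verts_def by (metis distinct_card length_map list.set_map)
qed

text \<open>For a graph without cycles these are \<open>\<infinity>\<close> and \<open>0\<close>.\<close>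

definition girth :: "'a pair_pre_digraph \<Rightarrow> enat" where
  "girth G = (INF p \<in> {p. graph_cycle G p}. enat (length p))"

definition circumference :: "'a pair_pre_digraph \<Rightarrow> enat" where
  "circumference G = (SUP p \<in> {p. graph_cycle G p}. enat (length p))"

definition weakly_pancyclic :: "'a pair_pre_digraph \<Rightarrow> bool" where
  "weakly_pancyclic G \<longleftrightarrow>
     (\<forall>l::nat. girth G \<le> enat l \<and> enat l \<le> circumference G
        \<longrightarrow> (\<exists>p. graph_cycle G p \<and> length p = l))"

definition extendable :: "'a pair_pre_digraph \<Rightarrow> ('a \<times> 'a) awalk \<Rightarrow> bool" where
  "extendable G p \<longleftrightarrow>
     (\<exists>q. graph_cycle G q \<and> length q = length p + 1 \<and> cycle_verts p \<subseteq> cycle_verts q)"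

definition fully_cycle_extendable :: "'a pair_pre_digraph \<Rightarrow> bool" where
  "fully_cycle_extendable G \<longleftrightarrow>
     (\<forall>u \<in> pverts G. \<exists>p. graph_cycle G p \<and> length p = 3 \<and> u \<in> cycle_verts p) \<and>
     (\<forall>p. graph_cycle G p \<and> length p < card (pverts G) \<longrightarrow> extendable G p)"

end

theory Submission
  imports Defs
begin

text \<open>
  Every edge of \<open>G\<close> lies on a triangle, and since \<open>G\<close> has no induced paw
  \<open>K\<^sub>1 + (K\<^sub>1 \<union> K\<^sub>2)\<close>, every edge dominates \<open>G\<close>.  In other words, \<open>G\<close> is complete multipartite
  with at least three parts.

  A cycle of order at least 4 can be shortened by one: either two vertices at distance two on the
  cycle are adjacent, or the cycle alternates between two parts, and a vertex of a third part
  replaces two consecutive vertices.  This gives (i).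

  A Hamiltonian cycle meets an independent set in at most half of its vertices, and the
  non-neighbours of a vertex are independent; hence \<open>2\<delta> \<ge> n\<close> if \<open>G\<close> is fully cycle extendable.
  Conversely, a vertex \<open>v\<close> off a cycle can be inserted into it unless every edge of the cycle has an
  end that is not adjacent to \<open>v\<close>.  In that case \<open>2\<delta> \<ge> n\<close> yields a neighbour \<open>w\<close> of \<open>v\<close> off the
  cycle.  If \<open>w\<close> cannot be inserted either, then the cycle alternates between the parts of \<open>v\<close> and
  \<open>w\<close>, and any common neighbour of \<open>v\<close> and \<open>w\<close> can be inserted.
\<close>

section \<open>Cycles as vertex lists\<close>

text \<open>Dropping or inserting a vertex is a local change of this list, while it would alter
  several arcs of a \<open>graph_cycle\<close>. The list cuts the cycle open, so its closing edge is
  a separate conjunct.\<close>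

definition vertex_cycle :: "'a pair_pre_digraph \<Rightarrow> 'a list \<Rightarrow> bool" where
  "vertex_cycle G vs \<longleftrightarrow> 3 \<le> length vs \<and> distinct vs \<and>
     successively (\<lambda>u v. (u, v) \<in> parcs G) vs \<and> (last vs, hd vs) \<in> parcs G"

lemma pcas_imp_successively:
  assumes "pcas u p v" "set p \<subseteq> E" "p \<noteq> []"
  shows "successively (\<lambda>x y. (x, y) \<in> E) (map fst p) \<and> hd (map fst p) = u
    \<and> (last (map fst p), v) \<in> E"
  using assms
proof (induction p arbitrary: u)
  case (Cons e p)
  then show ?case by (cases e; cases p) auto
qed simp

lemma successively_imp_pcas:
  assumes "successively (\<lambda>x y. (x, y) \<in> E) vs" "vs \<noteq> []" "(last vs, v) \<in> E"
  shows "\<exists>p. map fst p = vs \<and> set p \<subseteq> E \<and> pcas (hd vs) p v"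
  using assms
proof (induction vs)
  case (Cons x vs)
  show ?case
  proof (cases vs)
    case Nil
    with Cons.prems show ?thesis by (intro exI[of _ "[(x, v)]"]) auto
  next
    case (Cons y ys)
    then have "\<exists>p. map fst p = vs \<and> set p \<subseteq> E \<and> pcas (hd vs) p v"
      using Cons.prems by (intro Cons.IH) auto
    then obtain p where "map fst p = vs" "set p \<subseteq> E" "pcas (hd vs) p v" by blast
    with Cons Cons.prems show ?thesis by (intro exI[of _ "(x, y) # p"]) auto
  qed
qed simp

lemma pawalk_verts_eq_map_fst:
  assumes "pcas u p v"
  shows "pawalk_verts u p = map fst p @ [v]"
  using assms by (induction p arbitrary: u) auto

text \<open>The vertex sequence of a closed walk repeats its start at the end, so
  \<open>cycle\<close> demands distinctness only after removing the head.\<close>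

lemma distinct_tl_snoc_hd: "xs \<noteq> [] \<Longrightarrow> distinct (tl (xs @ [hd xs])) \<longleftrightarrow> distinct xs"
  by (cases xs) auto

lemma vertex_cycle_if_graph_cycle:
  assumes "pair_graph G" "graph_cycle G p"
  shows "vertex_cycle G (map fst p)"
proof -
  interpret pair_graph G by fact
  obtain u where p: "3 \<le> length p" "set p \<subseteq> parcs G" "pcas u p u" "distinct (tl (pawalk_verts u p))"
    using assms(2)
    by (auto simp: graph_cycle_def cycle_def awalk_def awalk_verts_with_proj_eq cas_with_proj_eq)
  then have "p \<noteq> []" by auto
  note * = pcas_imp_successively[OF p(3,2) this]
  then have "distinct (map fst p)"
    using p(4) \<open>p \<noteq> []\<close> distinct_tl_snoc_hd[of "map fst p"]
    by (simp add: pawalk_verts_eq_map_fst[OF p(3)])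
  then show ?thesis using * p(1) by (simp add: vertex_cycle_def)
qed

lemma graph_cycle_if_vertex_cycle:
  assumes "pair_graph G" and vs: "vertex_cycle G vs"
  obtains p where "graph_cycle G p" "map fst p = vs"
proof -
  interpret pair_graph G by fact
  have "vs \<noteq> []" using vs by (auto simp: vertex_cycle_def)
  with vs obtain p where p: "map fst p = vs" "set p \<subseteq> parcs G" "pcas (hd vs) p (hd vs)"
    using successively_imp_pcas[of "parcs G" vs "hd vs"] by (auto simp: vertex_cycle_def)
  have "distinct (tl (pawalk_verts (hd vs) p))"
    using vs p(1) distinct_tl_snoc_hd[OF \<open>vs \<noteq> []\<close>]
    by (simp add: pawalk_verts_eq_map_fst[OF p(3)] vertex_cycle_def)
  moreover have "hd vs \<in> pverts G" using vs in_arcsD2 by (auto simp: vertex_cycle_def)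
  moreover have "3 \<le> length p" using vs p(1) by (auto simp: vertex_cycle_def)
  ultimately have "graph_cycle G p" using p(2,3)
    by (auto simp: graph_cycle_def cycle_def awalk_def awalk_verts_with_proj_eq cas_with_proj_eq)
  then show thesis using p(1) by (rule that)
qed

lemma extendable_if_vertex_cycle:
  assumes "pair_graph G" "vertex_cycle G vs" "length vs = length p + 1" "fst ` set p \<subseteq> set vs"
  shows "extendable G p"
proof -
  from assms(1,2) obtain q where "graph_cycle G q" "map fst q = vs"
    by (rule graph_cycle_if_vertex_cycle)
  with assms(3,4) show ?thesis by (auto simp: extendable_def cycle_verts_def)
qed

section \<open>Consecutive entries of a list\<close>

lemma not_successively_split:
  assumes "\<not> successively R vs"
  obtains xs a b ys where "vs = xs @ [a, b] @ ys" "\<not> R a b"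
proof -
  have "\<exists>xs a b ys. vs = xs @ [a, b] @ ys \<and> \<not> R a b"
    using assms
  proof (induction vs rule: induct_list012)
    case (3 x y zs)
    show ?case
    proof (cases "R x y")
      case True
      with 3 obtain xs a b ys where "y # zs = xs @ [a, b] @ ys" "\<not> R a b" by auto
      then show ?thesis by (intro exI[of _ "x # xs"]) auto
    next
      case False
      then show ?thesis by (intro exI[of _ "[]"]) auto
    qed
  qed auto
  with that show thesis by blast
qed

text \<open>Every entry failing \<open>Q\<close> has a predecessor, as the head satisfies
  \<open>Q\<close>, and this predecessor satisfies \<open>Q\<close>. So the failing entries are at
  most as many as the others.\<close>

lemma length_le_twice_filter_if_hd:
  assumes "successively (\<lambda>a b. Q a \<or> Q b) xs" "xs \<noteq> []" "Q (hd xs)"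
  shows "length xs \<le> 2 * length (filter Q xs)"
  using assms
proof (induction xs rule: induct_list012)
  case (3 x y zs)
  then show ?case by (cases zs; cases "Q y") auto
qed auto

text \<open>The last hypothesis treats the closing edge of a cycle like the other edges. If the head
  fails \<open>Q\<close>, the last entry satisfies it, and the reversed list starts well.\<close>

lemma length_le_twice_filter:
  assumes "successively (\<lambda>a b. Q a \<or> Q b) xs" "xs \<noteq> []" "Q (last xs) \<or> Q (hd xs)"
  shows "length xs \<le> 2 * length (filter Q xs)"
proof (cases "Q (hd xs)")
  case False
  then have "length (rev xs) \<le> 2 * length (filter Q (rev xs))"
    using assms by (intro length_le_twice_filter_if_hd) (auto simp: hd_rev disj_commute)
  then show ?thesis by (simp flip: rev_filter)
qed (use assms length_le_twice_filter_if_hd in blast)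

section \<open>Graphs in which every edge dominates and lies on a triangle\<close>

text \<open>Contrapositively, the first axiom makes non-adjacency transitive; its classes are the
  parts of a complete multipartite graph. The second provides a third part once there is an
  edge.\<close>

locale edge_dominated_graph = pair_graph +
  assumes edge_dominates: "(x, z) \<in> parcs G \<Longrightarrow> y \<in> pverts G \<Longrightarrow> (x, y) \<in> parcs G \<or> (z, y) \<in> parcs G"
    and edge_in_triangle: "(x, z) \<in> parcs G \<Longrightarrow> \<exists>t. (x, t) \<in> parcs G \<and> (z, t) \<in> parcs G"
begin

abbreviation adj :: "'a \<Rightarrow> 'a \<Rightarrow> bool" where "adj u v \<equiv> (u, v) \<in> parcs G"

lemma adj_sym: "adj u v \<Longrightarrow> adj v u"
  using sym_arcs by (auto simp: symmetric_def dest: symD)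

lemma not_adj_self: "\<not> adj u u"
  using no_loops' by blast

lemma adj_in_verts: "adj u v \<Longrightarrow> u \<in> pverts G" "adj u v \<Longrightarrow> v \<in> pverts G"
  by (auto dest: in_arcsD1 in_arcsD2)

section \<open>Shortening cycles and weak pancyclicity\<close>

lemma vertex_cycle_subset:
  assumes "vertex_cycle G vs"
  shows "set vs \<subseteq> pverts G"
proof -
  from pair_graph_axioms assms obtain p where "graph_cycle G p" "map fst p = vs"
    by (rule graph_cycle_if_vertex_cycle)
  then have "set p \<subseteq> parcs G" "map fst p = vs" by (auto simp: graph_cycle_def cycle_def awalk_def)
  then show ?thesis using in_arcsD1 by fastforce
qed

lemma length_vertex_cycle_le:
  assumes "vertex_cycle G vs"
  shows "length vs \<le> card (pverts G)"
  using assms card_mono[OF pair_finite_verts vertex_cycle_subset[OF assms]]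
  by (simp add: distinct_card vertex_cycle_def)

lemma vertex_cycle_triangle:
  assumes "adj x y" "adj y z" "adj x z"
  shows "vertex_cycle G [x, y, z]"
  using assms not_adj_self adj_sym[of x z] by (auto simp: vertex_cycle_def)

text \<open>Adjacency to \<open>u\<close> propagates along the list: if \<open>x\<close> and
  \<open>z\<close> are not adjacent, the edge between \<open>u\<close> and \<open>x\<close> can
  dominate \<open>z\<close> only through \<open>u\<close>. If \<open>x\<close> and \<open>z\<close>
  are adjacent, they are the chord.\<close>

lemma adj_all_or_chord:
  assumes "adj u x" "adj u y" "set (x # y # zs) \<subseteq> pverts G"
  shows "(\<forall>z \<in> set (x # y # zs). adj u z) \<or>
    (\<exists>xs a b c ys. x # y # zs = xs @ [a, b, c] @ ys \<and> adj a c)"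
  using assms
proof (induction zs arbitrary: x y)
  case (Cons z zs)
  show ?case
  proof (cases "adj x z")
    case True
    then show ?thesis by (intro disjI2 exI[of _ "[]"]) auto
  next
    case False
    then have "adj u z" using edge_dominates[of u x z] Cons.prems by auto
    then have "(\<forall>w \<in> set (y # z # zs). adj u w) \<or>
        (\<exists>xs a b c ys. y # z # zs = xs @ [a, b, c] @ ys \<and> adj a c)"
      using Cons.prems by (intro Cons.IH) auto
    then consider "\<forall>w \<in> set (y # z # zs). adj u w"
      | xs a b c ys where "y # z # zs = xs @ [a, b, c] @ ys" "adj a c" by blast
    then show ?thesis
    proof cases
      case 1
      with Cons.prems show ?thesis by auto
    next
      case 2
      then show ?thesis by (intro disjI2 exI[of _ "x # xs"]) auto
    qed
  qed
qed auto

lemma shorten_vertex_cycle: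
  assumes vs: "vertex_cycle G vs" and "4 \<le> length vs"
  shows "\<exists>vs'. vertex_cycle G vs' \<and> Suc (length vs') = length vs"
proof -
  obtain x y z zs where eq: "vs = x # y # z # zs" and "zs \<noteq> []"
    using \<open>4 \<le> length vs\<close> by (auto simp: numeral_eq_Suc Suc_le_length_iff)
  then have "adj x y" using vs by (auto simp: vertex_cycle_def)
  then obtain u where u: "adj x u" "adj y u" using edge_in_triangle by blast
  have "set vs \<subseteq> pverts G" using vs by (rule vertex_cycle_subset)
  with u consider "\<forall>w \<in> set vs. adj u w"
    | xs a b c ys where "vs = xs @ [a, b, c] @ ys" "adj a c"
    using adj_all_or_chord[of u x y "z # zs"] adj_sym unfolding eq by blast
  then show ?thesis
  proof cases
    \<comment> \<open>Being adjacent to the whole cycle, \<open>u\<close> lies off it and can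
      replace both \<open>x\<close> and \<open>y\<close>.\<close>
    case 1
    then have "u \<notin> set vs" using not_adj_self by blast
    have "last zs \<in> set vs" using eq \<open>zs \<noteq> []\<close> by auto
    then have "vertex_cycle G (u # z # zs)"
      using vs 1 \<open>u \<notin> set vs\<close> \<open>zs \<noteq> []\<close> adj_sym[of u "last zs"] unfolding eq vertex_cycle_def
      by (auto simp: Suc_le_eq)
    then show ?thesis using eq by (intro exI[of _ "u # z # zs"]) auto
  next
    \<comment> \<open>The chord bypasses \<open>b\<close>; length at least 4 leaves a cycle of order
      at least 3.\<close>
    case 2
    have "vertex_cycle G (xs @ [a, c] @ ys)"
      using vs 2 \<open>4 \<le> length vs\<close> unfolding vertex_cycle_def
      by (auto simp: successively_append_iff successively_Cons last_append hd_append)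
    then show ?thesis using 2 by (intro exI[of _ "xs @ [a, c] @ ys"]) auto
  qed
qed

lemma vertex_cycle_of_smaller_length:
  assumes "vertex_cycle G vs" "3 \<le> l" "l \<le> length vs"
  shows "\<exists>vs'. vertex_cycle G vs' \<and> length vs' = l"
  using assms
proof (induction "length vs" arbitrary: vs)
  case (Suc k)
  show ?case
  proof (cases "l = length vs")
    case False
    then have "l \<le> k" "4 \<le> length vs" using Suc.prems Suc.hyps(2) by auto
    with shorten_vertex_cycle[OF Suc.prems(1)] obtain vs' where
      "vertex_cycle G vs'" "k = length vs'" using Suc.hyps(2) by auto
    with Suc.hyps(1)[of vs'] Suc.prems(2) \<open>l \<le> k\<close> show ?thesis by blast
  qed (use Suc.prems in blast)
qed auto

lemma weakly_pancyclic: "weakly_pancyclic G"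
  unfolding weakly_pancyclic_def
proof (intro allI impI)
  fix l :: nat
  assume l: "girth G \<le> enat l \<and> enat l \<le> circumference G"
  let ?C = "{p. graph_cycle G p}"
  have 3: "3 \<le> l"
  proof (rule ccontr)
    assume "\<not> 3 \<le> l"
    then have "enat (Suc l) \<le> girth G"
      unfolding girth_def by (intro INF_greatest) (auto simp: graph_cycle_def)
    also have "\<dots> \<le> enat l" using l by simp
    finally show False by simp
  qed
  \<comment> \<open>Otherwise the supremum is at most \<open>l - 1\<close>, a proper subtraction by
    \<open>3\<close>. A graph without cycles, of circumference 0, is excluded in the same
    way.\<close>
  have "\<exists>p. graph_cycle G p \<and> l \<le> length p"
  proof (rule ccontr)
    assume "\<not> ?thesis"
    then have "circumference G \<le> enat (l - 1)"
      unfolding circumference_def by (intro SUP_least) fastforce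
    with l have "enat l \<le> enat (l - 1)" by (blast intro: order.trans)
    with 3 show False by simp
  qed
  then obtain p where "graph_cycle G p" "l \<le> length (map fst p)" by auto
  then obtain vs where vs: "vertex_cycle G vs" "length vs = l"
    using vertex_cycle_of_smaller_length[OF vertex_cycle_if_graph_cycle[OF pair_graph_axioms]] 3
    by blast
  from pair_graph_axioms vs(1) obtain q where "graph_cycle G q" "map fst q = vs"
    by (rule graph_cycle_if_vertex_cycle)
  with vs(2) show "\<exists>p. graph_cycle G p \<and> length p = l" by auto
qed

section \<open>Extending cycles and the degree condition\<close>

text \<open>The negated hypothesis says that \<open>v\<close> sees both ends of some edge of the
  cycle, where it can be inserted. In this form, its failure gives the premises of
  \<open>length_le_twice_filter\<close> for the non-neighbours of \<open>v\<close>.\<close>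

lemma insert_vertex:
  assumes vs: "vertex_cycle G vs" and v: "v \<notin> set vs"
    and "\<not> (successively (\<lambda>a b. \<not> adj v a \<or> \<not> adj v b) vs \<and> (\<not> adj v (last vs) \<or> \<not> adj v (hd vs)))"
  shows "\<exists>vs'. vertex_cycle G vs' \<and> length vs' = Suc (length vs) \<and> set vs \<subseteq> set vs'"
proof (cases "adj v (last vs) \<and> adj v (hd vs)")
  case True
  then have "vertex_cycle G (v # vs)"
    using vs v adj_sym[of v "last vs"] by (cases vs) (auto simp: vertex_cycle_def)
  then show ?thesis by (intro exI[of _ "v # vs"]) auto
next
  case False
  with assms obtain xs a b ys where split: "vs = xs @ [a, b] @ ys" "adj v a" "adj v b"
    using not_successively_split by (metis (lifting))
  then have "vertex_cycle G (xs @ [a, v, b] @ ys)"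
    using vs v adj_sym[of v a] unfolding vertex_cycle_def
    by (auto simp: successively_append_iff successively_Cons last_append hd_append)
  then show ?thesis using split by (intro exI[of _ "xs @ [a, v, b] @ ys"]) auto
qed

text \<open>Each edge of the cycle dominates \<open>v\<close>, so no two consecutive vertices are
  non-neighbours of \<open>v\<close>, and at least half of the vertices are neighbours.\<close>

lemma card_le_twice_degree_of_hamiltonian:
  assumes vs: "vertex_cycle G vs" "length vs = card (pverts G)" and v: "v \<in> pverts G"
  shows "card (pverts G) \<le> 2 * card (neighborhood G v)"
proof -
  have sub: "set vs \<subseteq> pverts G" using vs(1) by (rule vertex_cycle_subset)
  have dom: "adj v a \<or> adj v b" if "adj a b" for a b
    using edge_dominates[OF that v] adj_sym by blast
  have "length vs \<le> 2 * length (filter (adj v) vs)"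
    using vs(1) dom unfolding vertex_cycle_def
    by (intro length_le_twice_filter) (blast intro: successively_mono, auto)
  also have "length (filter (adj v) vs) = card (set (filter (adj v) vs))"
    using vs(1) by (simp only: distinct_card distinct_filter vertex_cycle_def)
  also have "\<dots> \<le> card (neighborhood G v)"
    by (intro card_mono finite_subset[OF _ pair_finite_verts])
      (auto simp: neighborhood_def dest: adj_in_verts)
  finally show ?thesis using vs(2) by simp
qed

lemma extend_vertex_cycle:
  assumes vs: "vertex_cycle G vs" "length vs < card (pverts G)"
    and deg: "\<And>v. v \<in> pverts G \<Longrightarrow> card (pverts G) \<le> 2 * card (neighborhood G v)"
  shows "\<exists>vs'. vertex_cycle G vs' \<and> length vs' = Suc (length vs) \<and> set vs \<subseteq> set vs'"
proof (rule ccontr)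
  assume not_ext: "\<not> ?thesis"
  have sub: "set vs \<subseteq> pverts G" using vs(1) by (rule vertex_cycle_subset)
  have len: "card (set vs) = length vs" using vs(1) by (simp add: distinct_card vertex_cycle_def)
  have ne: "vs \<noteq> []" using vs(1) by (auto simp: vertex_cycle_def)
  have no_ins: "successively (\<lambda>a b. \<not> adj v a \<or> \<not> adj v b) vs"
    "\<not> adj v (last vs) \<or> \<not> adj v (hd vs)" if "v \<notin> set vs" for v
    using insert_vertex[OF vs(1) that] not_ext by blast+
  obtain v where v: "v \<in> pverts G" "v \<notin> set vs"
    using vs(2) len sub by (metis less_irrefl subsetI subset_antisym)
  let ?N = "neighborhood G v"
  \<comment> \<open>If all neighbours of \<open>v\<close> were on the cycle, they would be at most
    half of its vertices, against the degree bound, since the cycle is not Hamiltonian.\<close>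
  obtain w where w: "w \<notin> set vs" "adj v w"
  proof (rule ccontr)
    assume "\<not> thesis"
    with that have out: "?N \<subseteq> set vs" by (auto simp: neighborhood_def)
    have "length vs \<le> 2 * length (filter (\<lambda>a. \<not> adj v a) vs)"
      using no_ins[OF v(2)] ne by (intro length_le_twice_filter)
    also have "length (filter (\<lambda>a. \<not> adj v a) vs) = card (set (filter (\<lambda>a. \<not> adj v a) vs))"
      using vs(1) by (simp only: distinct_card distinct_filter vertex_cycle_def)
    also have "set (filter (\<lambda>a. \<not> adj v a) vs) = set vs - ?N" by (auto simp: neighborhood_def)
    also have "card (set vs - ?N) = length vs - card ?N"
      using out len by (simp add: card_Diff_subset finite_subset)
    finally have "2 * card ?N \<le> length vs"
      using card_mono[OF _ out] len by simp
    with deg[OF v(1)] vs(2) show False by simp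
  qed
  obtain u where u: "adj v u" "adj w u" using edge_in_triangle w(2) by blast
  \<comment> \<open>If \<open>a\<close> is adjacent to both \<open>v\<close> and \<open>w\<close>,
    its cyclic successor \<open>b\<close> is adjacent to neither, as neither can be inserted. But
    the edge between \<open>v\<close> and \<open>w\<close> dominates \<open>b\<close>.\<close>
  have indep: "\<not> adj v a \<or> \<not> adj w a" if "a \<in> set vs" for a
  proof (rule ccontr)
    assume a: "\<not> ?thesis"
    obtain b where b: "b \<in> set vs" "\<not> adj v b" "\<not> adj w b"
    proof -
      obtain xs ys where split: "vs = xs @ a # ys" using split_list[OF \<open>a \<in> set vs\<close>] by blast
      show thesis
      proof (cases ys)
        case Nil
        then have "\<not> adj v (hd vs)" "\<not> adj w (hd vs)"
          using no_ins(2)[OF v(2)] no_ins(2)[OF w(1)] a split by auto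
        with ne show thesis by (intro that) auto
      next
        case (Cons b zs)
        then have "\<not> adj v b" "\<not> adj w b"
          using no_ins(1)[OF v(2)] no_ins(1)[OF w(1)] a split
          by (auto simp: successively_append_iff)
        with Cons split show thesis by (intro that[of b]) auto
      qed
    qed
    then show False using edge_dominates[OF w(2)] sub by blast
  qed
  have "u \<notin> set vs" using indep u by blast
  \<comment> \<open>Since \<open>a\<close> misses \<open>v\<close> or \<open>w\<close>, the edge
    from that vertex to \<open>u\<close> dominates \<open>a\<close> through \<open>u\<close>. So
    \<open>u\<close> fits into any edge of the cycle, in particular the closing one.\<close>
  have all: "adj u a" if "a \<in> set vs" for a
  proof -
    have "a \<in> pverts G" using that sub by blast
    then show ?thesis
      using indep[OF that] u edge_dominates[of v u a] edge_dominates[of w u a] by blast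
  qed
  show False using no_ins(2)[OF \<open>u \<notin> set vs\<close>] all[of "hd vs"] all[of "last vs"] ne by auto
qed

lemma fully_cycle_extendable_iff:
  assumes nbr: "\<And>u. u \<in> pverts G \<Longrightarrow> neighborhood G u \<noteq> {}" and "pverts G \<noteq> {}"
  shows "fully_cycle_extendable G \<longleftrightarrow>
    (\<forall>v \<in> pverts G. card (pverts G) \<le> 2 * card (neighborhood G v))"
proof
  assume ext: "fully_cycle_extendable G"
  \<comment> \<open>Repeated extension of a triangle reaches every order up to that of
    \<open>G\<close>, hence a Hamiltonian cycle.\<close>
  have cyc: "\<exists>p. graph_cycle G p \<and> length p = 3 + k" if "3 + k \<le> card (pverts G)" for k
    using that
  proof (induction k)
    case 0
    then show ?case
      using ext \<open>pverts G \<noteq> {}\<close> by (auto simp: fully_cycle_extendable_def)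
  next
    case (Suc k)
    then obtain p where p: "graph_cycle G p" "length p = 3 + k" by auto
    with ext Suc.prems have "extendable G p" by (auto simp: fully_cycle_extendable_def)
    then obtain q where "graph_cycle G q" "length q = length p + 1"
      by (auto simp: extendable_def)
    with p(2) show ?case by auto
  qed
  obtain p where "graph_cycle G p"
    using ext \<open>pverts G \<noteq> {}\<close> unfolding fully_cycle_extendable_def by blast
  with length_vertex_cycle_le[OF vertex_cycle_if_graph_cycle[OF pair_graph_axioms]]
  have "3 \<le> card (pverts G)" unfolding graph_cycle_def by fastforce
  with cyc[of "card (pverts G) - 3"] obtain q where "graph_cycle G q" "length q = card (pverts G)"
    by auto
  then have "vertex_cycle G (map fst q)" "length (map fst q) = card (pverts G)"
    using vertex_cycle_if_graph_cycle[OF pair_graph_axioms] by auto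
  then show "\<forall>v \<in> pverts G. card (pverts G) \<le> 2 * card (neighborhood G v)"
    using card_le_twice_degree_of_hamiltonian by blast
next
  assume deg: "\<forall>v \<in> pverts G. card (pverts G) \<le> 2 * card (neighborhood G v)"
  show "fully_cycle_extendable G"
    unfolding fully_cycle_extendable_def
  proof (intro conjI ballI allI impI)
    fix u assume "u \<in> pverts G"
    then obtain v where v: "adj u v" using nbr by (auto simp: neighborhood_def)
    then obtain t where "adj u t" "adj v t" using edge_in_triangle by blast
    then have "vertex_cycle G [u, v, t]" using v by (intro vertex_cycle_triangle)
    from pair_graph_axioms this obtain p where p: "graph_cycle G p" "map fst p = [u, v, t]"
      by (rule graph_cycle_if_vertex_cycle)
    moreover have "length p = 3" using arg_cong[OF p(2), of length] by simp
    moreover have "u \<in> cycle_verts p"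
      using arg_cong[OF p(2), of set] by (simp add: cycle_verts_def)
    ultimately show "\<exists>p. graph_cycle G p \<and> length p = 3 \<and> u \<in> cycle_verts p" by blast
  next
    fix p assume p: "graph_cycle G p \<and> length p < card (pverts G)"
    then have "vertex_cycle G (map fst p)" "length (map fst p) < card (pverts G)"
      using vertex_cycle_if_graph_cycle[OF pair_graph_axioms] by auto
    then obtain vs where "vertex_cycle G vs" "length vs = Suc (length (map fst p))"
        "set (map fst p) \<subseteq> set vs"
      using extend_vertex_cycle deg by blast
    then show "extendable G p"
      by (intro extendable_if_vertex_cycle[OF pair_graph_axioms]) auto
  qed
qed

end

section \<open>Locally connected graphs without an induced paw\<close>

text \<open>\<open>connected\<close> refers to reachability in the symmetrised digraph, so
  \<open>S\<close> has to be closed along arcs in both directions.\<close>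

lemma connected_subset_if_closed:
  assumes "connected H" "u \<in> verts H" "u \<in> S"
    and closed: "\<And>e. e \<in> arcs H \<Longrightarrow> tail H e \<in> S \<longleftrightarrow> head H e \<in> S"
  shows "verts H \<subseteq> S"
proof
  fix v assume "v \<in> verts H"
  then have "(u, v) \<in> rtrancl_on (verts H) (parcs (mk_symmetric H))"
    using assms(1,2) by (auto simp: connected_def strongly_connected_def reachable_def)
  then show "v \<in> S"
    by (induction rule: rtrancl_on_induct) (use assms in \<open>auto simp: parcs_mk_symmetric\<close>)
qed

text \<open>The subgraph is induced by the image of \<open>g\<close>. \<open>induced_free\<close>
  has the isomorphism run from the subgraph to \<open>F\<close>, so it is built from the inverse of
  \<open>g\<close>.\<close>

lemma not_induced_freeI:
  assumes "pair_graph G" "pair_graph F"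
    and inj: "inj_on g (pverts F)" and img: "g ` pverts F \<subseteq> pverts G"
    and arcs: "\<And>u v. u \<in> pverts F \<Longrightarrow> v \<in> pverts F \<Longrightarrow> (u, v) \<in> parcs F \<longleftrightarrow> (g u, g v) \<in> parcs G"
  shows "\<not> induced_free F G"
proof -
  interpret G: pair_graph G by fact
  interpret F: pair_graph F by fact
  let ?H = "with_proj G \<restriction> (g ` pverts F)"
  let ?f = "the_inv_into (pverts F) g"
  let ?h = "\<lparr>iso_verts = ?f, iso_arcs = map_prod ?f ?f, iso_head = snd, iso_tail = fst\<rparr>"
  have f: "?f (g u) = u" if "u \<in> pverts F" for u
    using inj that by (rule the_inv_into_f_f)
  have inj_f: "inj_on ?f (g ` pverts F)" using inj by (rule inj_on_the_inv_into)
  have arcs_H: "arcs ?H = map_prod g g ` parcs F"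
  proof (intro set_eqI iffI)
    fix e assume "e \<in> arcs ?H"
    then obtain u v where e: "e = (g u, g v)" "u \<in> pverts F" "v \<in> pverts F" "(g u, g v) \<in> parcs G"
      by (cases e) auto
    then have "(u, v) \<in> parcs F" using arcs by blast
    with e(1) show "e \<in> map_prod g g ` parcs F" by (intro image_eqI[of _ _ "(u, v)"]) simp_all
  next
    fix e assume "e \<in> map_prod g g ` parcs F"
    then obtain u v where e: "e = (g u, g v)" "(u, v) \<in> parcs F" by auto
    moreover have "u \<in> pverts F" "v \<in> pverts F"
      using F.in_arcsD1[OF e(2)] F.in_arcsD2[OF e(2)] .
    ultimately show "e \<in> arcs ?H" using arcs by simp
  qed
  have ind: "induced_subgraph ?H (with_proj G)"
    using img by (intro G.induced_induce) auto
  have "pre_digraph.digraph_isomorphism ?H ?h"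
    unfolding pre_digraph.digraph_isomorphism_def
  proof (intro conjI)
    show "wf_digraph ?H" by (rule G.wellformed_induce_subgraph)
    show "inj_on (iso_verts ?h) (verts ?H)" using inj_f by simp
    have "inj_on (map_prod ?f ?f) (g ` pverts F \<times> g ` pverts F)"
      using inj_f inj_f by (rule map_prod_inj_on)
    then show "inj_on (iso_arcs ?h) (arcs ?H)"
      unfolding digraph_isomorphism.simps
      by (rule inj_on_subset) (auto simp: mem_Times_iff)
  qed auto
  moreover have "with_proj F = app_iso ?h ?H"
  proof (rule pre_digraph.equality)
    show "verts (with_proj F) = verts (app_iso ?h ?H)"
      by (simp add: image_image f)
    have "map_prod ?f ?f (map_prod g g e) = e" if "e \<in> parcs F" for e
      using that by (cases e) (auto simp: f dest: F.in_arcsD1 F.in_arcsD2)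
    then show "arcs (with_proj F) = arcs (app_iso ?h ?H)"
      unfolding app_iso_simps arcs_H by (simp add: image_image)
  qed auto
  ultimately show ?thesis using ind by (auto simp: induced_free_def digraph_iso_def)
qed

text \<open>Otherwise \<open>c, w, x, z\<close> induce a paw: the triangle \<open>c x z\<close> with
  \<open>w\<close> pendant at \<open>c\<close>.\<close>

lemma paw_free_adj:
  assumes "pair_graph G"
    and "induced_free
           (graph_join (complete_graph 1) (graph_union (complete_graph 1) (complete_graph 2))) G"
    and "(c, w) \<in> parcs G" "(c, x) \<in> parcs G" "(c, z) \<in> parcs G" "(x, z) \<in> parcs G"
  shows "(w, x) \<in> parcs G \<or> (w, z) \<in> parcs G"
proof (rule ccontr)
  assume contra: "\<not> ?thesis"
  interpret pair_graph G by fact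
  let ?F = "graph_join (complete_graph 1) (graph_union (complete_graph 1) (complete_graph 2))"
  let ?g = "case_sum (\<lambda>_. c) (case_sum (\<lambda>_. w) (\<lambda>i. if i = 0 then x else z))"
  have sym: "(b, a) \<in> parcs G" if "(a, b) \<in> parcs G" for a b
    using that sym_arcs by (auto simp: symmetric_def dest: symD)
  note edges = assms(3-6) assms(3-6)[THEN sym] contra
  have non: "(x, w) \<notin> parcs G" "(z, w) \<notin> parcs G" using contra sym by blast+
  have irr: "(a, a) \<notin> parcs G" for a using no_loops' by blast
  \<comment> \<open>If \<open>w\<close> were \<open>x\<close> or \<open>z\<close>, the edge between
    \<open>x\<close> and \<open>z\<close> would contradict \<open>contra\<close>.\<close>
  have dist: "c \<noteq> w" "c \<noteq> x" "c \<noteq> z" "x \<noteq> z" "w \<noteq> x" "w \<noteq> z"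
    using edges irr by auto
  have verts: "pverts ?F = {Inl 0, Inr (Inl 0), Inr (Inr 0), Inr (Inr 1)}"
    by (auto simp: graph_join_def graph_union_def complete_graph_def)
  have Inl_arc: "(Inl a, Inl b) \<in> map_prod Inl Inl ` S \<longleftrightarrow> (a, b) \<in> S"
    and Inr_arc: "(Inr a, Inr b) \<in> map_prod Inr Inr ` S \<longleftrightarrow> (a, b) \<in> S" for a b S
    by auto
  have "\<not> induced_free ?F G"
  proof (rule not_induced_freeI[where g = ?g])
    show "pair_graph ?F"
      by (intro pair_graph_graph_join pair_graph_graph_union pair_graph_complete_graph)
    show "inj_on ?g (pverts ?F)" unfolding verts using dist by (auto simp: inj_on_def)
    show "?g ` pverts ?F \<subseteq> pverts G"
      unfolding verts using edges by (auto dest: in_arcsD1 in_arcsD2)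
    show "(u, v) \<in> parcs ?F \<longleftrightarrow> (?g u, ?g v) \<in> parcs G"
      if "u \<in> pverts ?F" "v \<in> pverts ?F" for u v
      using that edges non irr unfolding verts
      by (auto simp: graph_join_def graph_union_def complete_graph_def Inl_arc Inr_arc)
  qed fact
  with assms(2) show False by blast
qed

section \<open>From local connectivity and paw-freeness to dominating edges\<close>

lemma edge_dominated_graphI:
  assumes "pair_graph G" "connected (with_proj G)" "locally_connected G"
    and free: "induced_free
           (graph_join (complete_graph 1) (graph_union (complete_graph 1) (complete_graph 2))) G"
    and card: "card (pverts G) \<ge> 3"
  shows "edge_dominated_graph G"
proof -
  interpret pair_graph G by fact
  have sym: "(b, a) \<in> parcs G" if "(a, b) \<in> parcs G" for a b
    using that sym_arcs by (auto simp: symmetric_def dest: symD)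
  note paw = paw_free_adj[OF assms(1) free]
  \<comment> \<open>Without a triangle on the edge, \<open>z\<close> is isolated in the graph
    induced by the neighbours of \<open>x\<close>, whose connectedness leaves only
    \<open>z\<close>.\<close>
  have leaf: "neighborhood G x = {z}"
    if xz: "(x, z) \<in> parcs G" and no: "\<nexists>t. (x, t) \<in> parcs G \<and> (z, t) \<in> parcs G" for x z
  proof -
    let ?H = "with_proj G \<restriction> neighborhood G x"
    have "connected ?H"
      using assms(3) in_arcsD1[OF xz] by (auto simp: locally_connected_def)
    moreover have "tail ?H e \<in> {z} \<longleftrightarrow> head ?H e \<in> {z}" if "e \<in> arcs ?H" for e
      using that no sym by (cases e) (auto simp: neighborhood_def)
    ultimately have "verts ?H \<subseteq> {z}"
      using connected_subset_if_closed[of ?H z "{z}"] xz by (auto simp: neighborhood_def)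
    then show ?thesis using xz by (auto simp: neighborhood_def)
  qed
  \<comment> \<open>Otherwise \<open>x\<close> and \<open>z\<close> are each other's only
    neighbours, and connectedness leaves just two vertices.\<close>
  have tri: "\<exists>t. (x, t) \<in> parcs G \<and> (z, t) \<in> parcs G" if xz: "(x, z) \<in> parcs G" for x z
  proof (rule ccontr)
    assume no: "\<not> ?thesis"
    have "neighborhood G x = {z}" "neighborhood G z = {x}"
      using leaf[OF xz] leaf[OF sym[OF xz]] no by blast+
    then have "e \<in> {(x, z), (z, x)}" if "e \<in> parcs G" "fst e \<in> {x, z} \<or> snd e \<in> {x, z}" for e
      using that sym[of "fst e" "snd e"] by (cases e) (auto simp: neighborhood_def set_eq_iff)
    then have "pverts G \<subseteq> {x, z}"
      using connected_subset_if_closed[OF assms(2), of x "{x, z}"] in_arcsD1[OF xz] by fastforce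
    then have "card (pverts G) \<le> card {x, z}" by (intro card_mono) auto
    also have "\<dots> \<le> 2" by (simp add: card_insert_if)
    finally show False using card by simp
  qed
  have dom: "(x, y) \<in> parcs G \<or> (z, y) \<in> parcs G"
    if xz: "(x, z) \<in> parcs G" and y: "y \<in> pverts G" for x y z
  proof -
    let ?S = "{y. (x, y) \<in> parcs G \<or> (z, y) \<in> parcs G}"
    \<comment> \<open>Vertices at distance one from a neighbour of \<open>p\<close> are still
      dominated by \<open>p q\<close>, so \<open>?S\<close> is closed under adjacency. If
      \<open>a\<close> sees \<open>q\<close>, a paw at \<open>a\<close> decides. Otherwise a
      triangle \<open>p q t\<close> is used: paws at \<open>p\<close>, \<open>a\<close> and
      \<open>t\<close> force in turn the edges \<open>a t\<close>, \<open>b t\<close> and one from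
      \<open>b\<close> to \<open>p\<close> or \<open>q\<close>.\<close>
    have key: "(p, b) \<in> parcs G \<or> (q, b) \<in> parcs G"
      if pq: "(p, q) \<in> parcs G" and pa: "(p, a) \<in> parcs G" and ab: "(a, b) \<in> parcs G" for p q a b
    proof (rule ccontr)
      assume "\<not> ?thesis"
      then have nb: "(b, p) \<notin> parcs G" "(b, q) \<notin> parcs G" using sym by blast+
      obtain t where t: "(p, t) \<in> parcs G" "(q, t) \<in> parcs G" using tri[OF pq] by blast
      show False
      proof (cases "(a, q) \<in> parcs G")
        case True
        then show False using paw[OF ab sym[OF pa] True pq] nb by blast
      next
        case False
        then have at: "(a, t) \<in> parcs G" using paw[OF pa pq t(1) t(2)] by blast
        then have bt: "(b, t) \<in> parcs G" using paw[OF ab sym[OF pa] at t(1)] nb by blast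
        show False using paw[OF sym[OF bt] sym[OF t(1)] sym[OF t(2)] pq] nb by blast
      qed
    qed
    have step: "b \<in> ?S" if "(a, b) \<in> parcs G" "a \<in> ?S" for a b
      using that key[OF xz, of a b] key[OF sym[OF xz], of a b] by blast
    have "verts (with_proj G) \<subseteq> ?S"
    proof (rule connected_subset_if_closed[OF assms(2)])
      show "x \<in> verts (with_proj G)" using in_arcsD1[OF xz] by simp
      show "x \<in> ?S" using sym[OF xz] by blast
      show "tail (with_proj G) e \<in> ?S \<longleftrightarrow> head (with_proj G) e \<in> ?S"
        if "e \<in> arcs (with_proj G)" for e
      proof -
        obtain a b where e: "e = (a, b)" by (cases e)
        with that have ab: "(a, b) \<in> parcs G" by simp
        show ?thesis using step[OF ab] step[OF sym[OF ab]] unfolding e by auto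
      qed
    qed
    with y show ?thesis by auto
  qed
  show ?thesis
    by (intro edge_dominated_graph.intro edge_dominated_graph_axioms.intro assms(1) dom tri)
qed

lemma neighborhood_nonempty:
  assumes "pair_graph G" "locally_connected G" "u \<in> pverts G"
  shows "neighborhood G u \<noteq> {}"
proof -
  interpret pair_graph G by fact
  have "connected (with_proj G \<restriction> neighborhood G u)"
    using assms(2,3) by (auto simp: locally_connected_def)
  then show ?thesis by (auto simp: connected_def strongly_connected_def)
qed

lemma out_degree_eq_card_neighborhood: "out_degree (with_proj G) u = card (neighborhood G u)"
proof -
  have "out_arcs (with_proj G) u = Pair u ` neighborhood G u"
    by (auto simp: out_arcs_def neighborhood_def)
  then show ?thesis by (simp add: out_degree_def card_image inj_on_def)
qed

theorem theorem3:
  fixes G :: "'a pair_pre_digraph"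
  assumes "pair_graph G"
    and "connected (with_proj G)"
    and "locally_connected G"
    and "induced_free
           (graph_join (complete_graph 1) (graph_union (complete_graph 1) (complete_graph 2))) G"
    and "card (pverts G) \<ge> 3"
  shows "weakly_pancyclic G \<and>
         (fully_cycle_extendable G \<longleftrightarrow> 2 * min_degree G \<ge> card (pverts G))"
proof -
  interpret edge_dominated_graph G using assms by (rule edge_dominated_graphI)
  have ne: "pverts G \<noteq> {}" using assms(5) by auto
  have "min_degree G \<in> (\<lambda>v. card (neighborhood G v)) ` pverts G"
    using Min_in[of "(\<lambda>v. card (neighborhood G v)) ` pverts G"] ne
    by (simp add: min_degree_def out_degree_eq_card_neighborhood)
  moreover have "min_degree G \<le> card (neighborhood G v)" if "v \<in> pverts G" for v
    using that by (simp add: min_degree_def out_degree_eq_card_neighborhood)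
  ultimately have "2 * min_degree G \<ge> card (pverts G) \<longleftrightarrow>
      (\<forall>v \<in> pverts G. card (pverts G) \<le> 2 * card (neighborhood G v))"
    by fastforce
  also have "\<dots> \<longleftrightarrow> fully_cycle_extendable G"
    using fully_cycle_extendable_iff[OF neighborhood_nonempty[OF assms(1,3)] ne] by simp
  finally show ?thesis using weakly_pancyclic by simp
qed

end
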